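(* Let $G$ be a group, let $\Gamma=(V_\Gamma,E_\Gamma)$ be a finite simple graph with ordered vertices $v_1,\dots,v_n$, and let $\Psi_1$ and $\Psi_2$ be two $G$-gain functions on $\Gamma$, with adjacency matrices $A\in M_n(\mathbb{C}G)$ and $B\in M_n(\mathbb{C}G)$, respectively. Then $(\Gamma,\Psi_1)$ and $(\Gamma,\Psi_2)$ are switching equivalent if and only if there exists a diagonal matrix $F\in M_n(\mathbb{C}G)$, with $F_{i,i}\in G$ for each $i=1,\dots,n$, such that $F^*AF=B$.
   Context: $G$ is an arbitrary (finite or infinite) group. The edges of $\Gamma$ are regarded as ordered pairs, with no loops and no multiple edges, and $(v,u)\in E_\Gamma$ if and only if $(u,v)\in E_\Gamma$. A $G$-gain function on $\Gamma$ is a map $\Psi\colon E_\Gamma\to G$ with $\Psi(u,v)=\Psi(v,u)^{-1}$ for all $(u,v)\in E_\Gamma$; the pair $(\Gamma,\Psi)$ is called a $G$-gain graph. $\mathbb{C}G$ is the group algebra of finite $\mathbb{C}$-linear combinations $f=\sum_{x\in G}f_x x$, with involution $f^*=\sum_{x\in G}\overline{f_x}\,x^{-1}$; $G$ is regarded as a subset of $\mathbb{C}G$. $M_n(\mathbb{C}G)$ is the algebra of $n\times n$ matrices with entries in $\mathbb{C}G$, with the usual matrix product $(FH)_{i,j}=\sum_{k}F_{i,k}H_{k,j}$ and involution $(F^* )_{i,j}=(F_{j,i})^*$. The adjacency matrix of $(\Gamma,\Psi)$ is the matrix in $M_n(\mathbb{C}G)$ whose $(i,j)$ entry is $\Psi(v_i,v_j)$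 if $(v_i,v_j)\in E_\Gamma$ and $0$ otherwise. $(\Gamma,\Psi_1)$ and $(\Gamma,\Psi_2)$ are switching equivalent if there exists $f\colon V_\Gamma\to G$ such that $\Psi_2(v_i,v_j)=f(v_i)^{-1}\Psi_1(v_i,v_j)f(v_j)$ for all $(v_i,v_j)\in E_\Gamma$. *)

theory Defs
  imports
    Complex_Main
    "HOL-Library.Poly_Mapping"
    "Graph_Theory.Pair_Digraph"
    "Jordan_Normal_Form.Matrix"
begin

text \<open>
  The group G is an arbitrary type of class \<open>group_add\<close>, which does not assume commutativity.
  It is thus written additively: x + y, -x and 0 are the product, the inverse and the identity
  of G.  The group algebra is the type of finitely supported functions with its library
  multiplication, which is convolution.
\<close>

type_synonym 'g group_algebra = "'g \<Rightarrow>\<^sub>0 complex"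

definition group_elem :: "'g \<Rightarrow> 'g::group_add group_algebra" where
  "group_elem x = Poly_Mapping.single x 1"

definition ga_star :: "'g::group_add group_algebra \<Rightarrow> 'g group_algebra" where
  "ga_star f =
     (\<Sum>x\<in>Poly_Mapping.keys f. Poly_Mapping.single (- x) (cnj (Poly_Mapping.lookup f x)))"

definition mat_star :: "'g::group_add group_algebra mat \<Rightarrow> 'g group_algebra mat" where
  "mat_star F = mat (dim_col F) (dim_row F) (\<lambda>(i, j). ga_star (F $$ (j, i)))"

lemma lookup_ga_star:
  "Poly_Mapping.lookup (ga_star f) x = cnj (Poly_Mapping.lookup f (- x))"
proof -
  have "Poly_Mapping.lookup (ga_star f) x =
      (\<Sum>y\<in>Poly_Mapping.keys f. if y = - x then cnj (Poly_Mapping.lookup f y) else 0)"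
    unfolding ga_star_def lookup_sum
    by (intro sum.cong refl) (auto simp: lookup_single when_def)
  also have "\<dots> = cnj (Poly_Mapping.lookup f (- x))"
    by (simp add: in_keys_iff)
  finally show ?thesis .
qed

text \<open>
  A gain function is only constrained on the edges; its values elsewhere are irrelevant to
  all notions below.
\<close>

definition gain_function :: "'v pair_pre_digraph \<Rightarrow> ('v \<times> 'v \<Rightarrow> 'g::group_add) \<Rightarrow> bool" where
  "gain_function \<Gamma> \<Psi> \<longleftrightarrow> (\<forall>(u, v) \<in> parcs \<Gamma>. \<Psi> (u, v) = - \<Psi> (v, u))"

definition switching_equivalent ::
    "'v pair_pre_digraph \<Rightarrow> ('v \<times> 'v \<Rightarrow> 'g::group_add) \<Rightarrow> ('v \<times> 'v \<Rightarrow> 'g) \<Rightarrow> bool" where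
  "switching_equivalent \<Gamma> \<Psi>1 \<Psi>2 \<longleftrightarrow>
     (\<exists>f :: 'v \<Rightarrow> 'g. \<forall>(u, v) \<in> parcs \<Gamma>. \<Psi>2 (u, v) = - f u + \<Psi>1 (u, v) + f v)"

text \<open>
  An ordering of the vertices is a list without repetitions; matrix indices and list
  positions both start at 0.
\<close>

definition vertex_ordering :: "'v pair_pre_digraph \<Rightarrow> 'v list \<Rightarrow> bool" where
  "vertex_ordering \<Gamma> vs \<longleftrightarrow> distinct vs \<and> set vs = pverts \<Gamma>"

definition gain_adjacency_matrix ::
    "'v pair_pre_digraph \<Rightarrow> 'v list \<Rightarrow> ('v \<times> 'v \<Rightarrow> 'g::group_add) \<Rightarrow> 'g group_algebra mat" where
  "gain_adjacency_matrix \<Gamma> vs \<Psi> = mat (length vs) (length vs) (\<lambda>(i, j).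
     if (vs ! i, vs ! j) \<in> parcs \<Gamma> then group_elem (\<Psi> (vs ! i, vs ! j)) else 0)"

end

theory Submission
  imports Defs
begin

text \<open>A diagonal matrix with entries in G is the same datum as a map from indices to G, that
  is, a switching function read along the vertex ordering. The star of a group element is its
  inverse, so conjugating by such a matrix multiplies the (i, j) entry by the inverse of the i-th
  group element on the left and by the j-th one on the right, as switching does to gains. Zero
  entries stay zero, and G embeds injectively in its group algebra, so equality of matrices is
  equality of gains on the arcs: \<open>mat_diag_conj_eq_gain_adjacency_matrix_iff\<close>. It
  remains to pass between vertices and indices.\<close>

text \<open>The support of \<open>group_elem x\<close> is the singleton of \<open>x\<close>, since
  the coefficient 1 is nonzero.\<close>

lemma group_elem_eq_iff: "group_elem x = group_elem y \<longleftrightarrow> x = y"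
proof
  assume "group_elem x = group_elem y"
  then have "Poly_Mapping.keys (group_elem x) = Poly_Mapping.keys (group_elem y)"
    by simp
  then show "x = y"
    by (simp add: group_elem_def)
qed simp

lemma group_elem_mult: "group_elem x * group_elem y = group_elem (x + y)"
  by (simp add: group_elem_def mult_single)

lemma ga_star_group_elem: "ga_star (group_elem x) = group_elem (- x)"
  by (simp add: ga_star_def group_elem_def)

lemma ga_star_zero: "ga_star 0 = 0"
  by (simp add: ga_star_def)

lemma mat_star_mat_diag: "mat_star (mat_diag n d) = mat_diag n (\<lambda>i. ga_star (d i))"
  by (rule eq_matI) (auto simp: mat_star_def mat_diag_def ga_star_zero)

lemma diagonal_mat_eq_mat_diag:
  assumes "F \<in> carrier_mat n n" and "diagonal_mat F"
  shows "F = mat_diag n (\<lambda>i. F $$ (i, i))"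
  using assms by (intro eq_matI) (auto simp: mat_diag_def diagonal_mat_def)

text \<open>Multiplying by a diagonal matrix on the left scales rows and on the right scales
  columns, so each entry of the triple product is a single product of group elements, or
  zero.\<close>

lemma mat_diag_conj_gain_adjacency_matrix:
  fixes d :: "nat \<Rightarrow> 'g::group_add"
    and vs :: "'v list"
  defines "F \<equiv> mat_diag (length vs) (\<lambda>i. group_elem (d i))"
  shows "mat_star F * gain_adjacency_matrix \<Gamma> vs \<Psi> * F = mat (length vs) (length vs) (\<lambda>(i, j).
    if (vs ! i, vs ! j) \<in> parcs \<Gamma>
    then group_elem (- d i + \<Psi> (vs ! i, vs ! j) + d j) else 0)"
proof -
  let ?A = "gain_adjacency_matrix \<Gamma> vs \<Psi>"
  have A: "?A \<in> carrier_mat (length vs) (length vs)"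
    by (simp add: gain_adjacency_matrix_def)
  show ?thesis
    unfolding F_def mat_star_mat_diag mat_diag_mult_left[OF A] mat_diag_mult_right[OF mat_carrier]
    by (rule eq_matI) (auto simp: gain_adjacency_matrix_def ga_star_group_elem group_elem_mult)
qed

text \<open>Both matrices vanish off the arcs, so only entries at arcs impose a condition. Indexing
  \<open>d\<close> by positions lets both directions of the theorem use this.\<close>

lemma mat_diag_conj_eq_gain_adjacency_matrix_iff:
  fixes d :: "nat \<Rightarrow> 'g::group_add"
    and vs :: "'v list"
  defines "F \<equiv> mat_diag (length vs) (\<lambda>i. group_elem (d i))"
  shows "mat_star F * gain_adjacency_matrix \<Gamma> vs \<Psi>1 * F = gain_adjacency_matrix \<Gamma> vs \<Psi>2 \<longleftrightarrow>
    (\<forall>i<length vs. \<forall>j<length vs. (vs ! i, vs ! j) \<in> parcs \<Gamma> \<longrightarrow>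
      \<Psi>2 (vs ! i, vs ! j) = - d i + \<Psi>1 (vs ! i, vs ! j) + d j)"
  unfolding F_def mat_diag_conj_gain_adjacency_matrix
  unfolding gain_adjacency_matrix_def
  by (auto simp: mat_eq_iff group_elem_eq_iff)

theorem theorem1:
  fixes \<Gamma> :: "'v pair_pre_digraph"
    and vs :: "'v list"
    and n :: nat
    and \<Psi>1 \<Psi>2 :: "'v \<times> 'v \<Rightarrow> 'g::group_add"
    and A B :: "'g group_algebra mat"
  assumes "pair_graph \<Gamma>"
    and "vertex_ordering \<Gamma> vs" and "length vs = n"
    and "gain_function \<Gamma> \<Psi>1" and "gain_function \<Gamma> \<Psi>2"
    and "A = gain_adjacency_matrix \<Gamma> vs \<Psi>1" and "B = gain_adjacency_matrix \<Gamma> vs \<Psi>2"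
  shows "switching_equivalent \<Gamma> \<Psi>1 \<Psi>2 \<longleftrightarrow>
    (\<exists>F \<in> carrier_mat n n. diagonal_mat F \<and> (\<forall>i<n. F $$ (i, i) \<in> range group_elem) \<and>
       mat_star F * A * F = B)"
proof
  assume "switching_equivalent \<Gamma> \<Psi>1 \<Psi>2"
  then obtain f where f: "\<forall>(u, v) \<in> parcs \<Gamma>. \<Psi>2 (u, v) = - f u + \<Psi>1 (u, v) + f v"
    by (auto simp: switching_equivalent_def)
  let ?F = "mat_diag n (\<lambda>i. group_elem (f (vs ! i)))"
  have "mat_star ?F * A * ?F = B"
    using f mat_diag_conj_eq_gain_adjacency_matrix_iff[of vs "\<lambda>i. f (vs ! i)"]
    unfolding assms(6,7) assms(3)[symmetric] by fast
  moreover have "diagonal_mat ?F" "\<forall>i<n. ?F $$ (i, i) \<in> range group_elem"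
    by (auto simp: diagonal_mat_def mat_diag_def)
  ultimately show "\<exists>F \<in> carrier_mat n n. diagonal_mat F \<and>
      (\<forall>i<n. F $$ (i, i) \<in> range group_elem) \<and> mat_star F * A * F = B"
    by (intro bexI[of _ ?F]) auto
next
  assume "\<exists>F \<in> carrier_mat n n. diagonal_mat F \<and>
      (\<forall>i<n. F $$ (i, i) \<in> range group_elem) \<and> mat_star F * A * F = B"
  then obtain F where F: "F \<in> carrier_mat n n" "diagonal_mat F" "mat_star F * A * F = B"
    and "\<forall>i<n. \<exists>x. F $$ (i, i) = group_elem x"
    by blast
  then obtain d where d: "\<forall>i<n. F $$ (i, i) = group_elem (d i)"
    by metis
  \<comment> \<open>The values of \<open>d\<close> from \<open>n\<close> on are arbitrary; only
    those below \<open>n\<close> enter the matrix.\<close>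
  have F_eq: "F = mat_diag n (\<lambda>i. group_elem (d i))"
    using d by (subst diagonal_mat_eq_mat_diag[OF F(1,2)]) (auto simp: mat_diag_def)
  have gains: "\<forall>i<n. \<forall>j<n. (vs ! i, vs ! j) \<in> parcs \<Gamma> \<longrightarrow>
      \<Psi>2 (vs ! i, vs ! j) = - d i + \<Psi>1 (vs ! i, vs ! j) + d j"
    using F(3) mat_diag_conj_eq_gain_adjacency_matrix_iff[of vs d \<Gamma> \<Psi>1 \<Psi>2]
    unfolding F_eq assms(3,6,7) by blast
  interpret pair_graph \<Gamma> by fact
  \<comment> \<open>The position of a vertex in the ordering, used to turn the diagonal
    \<open>d\<close> into a function on vertices.\<close>
  define idx where "idx = inv_into {..<n} ((!) vs)"
  have "bij_betw ((!) vs) {..<n} (pverts \<Gamma>)"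
    using assms(2,3) by (auto simp: vertex_ordering_def intro: bij_betw_nth)
  then have idx: "idx v < n" "vs ! idx v = v" if "v \<in> pverts \<Gamma>" for v
    using that bij_betw_inv_into bij_betw_apply bij_betw_inv_into_right
    unfolding idx_def by fastforce+
  \<comment> \<open>Both ends of an arc are vertices of the graph, so their positions are below
    \<open>n\<close> and \<open>gains\<close> applies to them.\<close>
  have "\<Psi>2 (u, v) = - d (idx u) + \<Psi>1 (u, v) + d (idx v)" if "(u, v) \<in> parcs \<Gamma>" for u v
    using that gains idx[of u] idx[of v] in_arcsD1[OF that] in_arcsD2[OF that] by metis
  then show "switching_equivalent \<Gamma> \<Psi>1 \<Psi>2"
    unfolding switching_equivalent_def by (intro exI[of _ "\<lambda>v. d (idx v)"]) auto
qed

end
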